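(* Let $G$ be a finite normal form game with players $N=\{1,\dots,n\}$, strategy sets $S_i$ with $|S_i|=k_i$, and payoffs $c_i:S\to\mathbb{R}$. The following three statements are equivalent. (1) $G$ is a coset weighted pure potential game. (2) There exist a function $P:S\to\mathbb{R}$ and a set of coset-depending weights $w_i(s_{-i})>0$ such that for every $i\in N$, every $s_{-i}\in S_{-i}$ and every $s=(s_i,s_{-i})\in S$, $$c_i(s)=w_i(s_{-i})P(s)-w_i(s_{-i})\sum_{x\in S_i}P(x,s_{-i}).$$ (3) There exist a function $P:S\to\mathbb{R}$ and a set of coset-depending weights $w_i(s_{-i})>0$ such that for every $i\in N$, every $s_{-i}\in S_{-i}$ and all $x,y\in S_i$, $$\sum_{z\in S_i}c_i(z,s_{-i})=0,\qquad c_i(x,s_{-i})-c_i(y,s_{-i})=w_i(s_{-i})\left(P(x,s_{-i})-P(y,s_{-i})\right).$$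
   Context: Strategy sets are $S_i=\{1,\dots,k_i\}$ with $k_i\ge2$, $S=\prod_i S_i$, $S_{-i}=\prod_{j\ne i}S_j$; coset-depending weights are functions $w_i:S_{-i}\to(0,\infty)$, $i\in N$. Put $k=\prod_j k_j$. Let $\delta_m^j$ be the $j$-th column of the identity matrix $I_m$; for a profile $s=(s_1,\dots,s_n)$ put $x_j=\delta_{k_j}^{s_j}$. The structure vector of $c_i$ is the row vector $V_i^c\in\mathbb{R}^k$ with $c_i(s)=V_i^c(x_1\otimes\cdots\otimes x_n)$ for all $s$, and $V_G=[V_1^c,\dots,V_n^c]\in\mathbb{R}^{nk}$. Given weights, the row vector $V_i^w\in\mathbb{R}^{k/k_i}$ is defined by $w_i(s_{-i})=V_i^w\,\bigotimes_{j\ne i}x_j$ (factors in increasing order of $j$). $E_i:=I_{k_1\cdots k_{i-1}}\otimes\mathbf{1}_{k_i}\otimes I_{k_{i+1}\cdots k_n}$ ($\mathbf{1}_m$ is the all-ones column of length $m$, empty products are $1$), and $\Lambda_i$ is the $k\times k$ diagonal matrix whose diagonal entries are the entries of $V_i^wE_i^T\in\mathbb{R}^k$. Let $$B_{cw}^P=\begin{bmatrix}\Lambda_1-\frac1{k_1}\Lambda_1E_1E_1^T\\ \vdots\\ \Lambda_n-\frac1{k_n}\Lambda_nE_nE_n^T\end{bmatrix}\in\mathbb{R}^{nk\times k}.$$ The coset weighted pure potential subspace (for the given weights) is $\mathcal{P}^{cw}=\mathrm{Span}(B_{cw}^P)$, the column span. $G$ is a coset weighted pure potential game if there are weights $w_i(s_{-i})>0$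 such that $V_G^T\in\mathcal{P}^{cw}$.
   Formalization: In (2) the sum over x in S_i carries an added factor 1/k_i, i.e. c_i(s) = w_i(s_{-i})P(s) − w_i(s_{-i})(1/k_i)Σ_x P(x,s_{-i}); as printed (2) does not imply (3), e.g. P = 1, w_i = 1, c_i = 1 − k_i. *)

theory Defs
  imports
    "HOL-Library.FuncSet"
    "Jordan_Normal_Form.Matrix"
    "Jordan_Normal_Form.VS_Connect"
begin

section \<open>Profiles, games and weights\<close>

text \<open>
  A game with \<open>n\<close> players is given by the numbers \<open>k i\<close> of strategies and the payoffs
  \<open>c i\<close>, for \<open>i \<in> {1..n}\<close>. Strategies and players are numbered from 1, whereas the
  entries of library vectors and matrices are numbered from 0.
  \<open>profiles {1..n} k\<close> is \<open>S\<close>, and \<open>profiles ({1..n} - {i}) k\<close> is \<open>S\<^sub>-\<^sub>i\<close>. For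
  \<open>t \<in> S\<^sub>-\<^sub>i\<close> the profile \<open>(x, t)\<close> is \<open>t(i := x)\<close>.
\<close>

definition strategies :: "(nat \<Rightarrow> nat) \<Rightarrow> nat \<Rightarrow> nat set" where
  "strategies k i = {1..k i}"

definition profiles :: "nat set \<Rightarrow> (nat \<Rightarrow> nat) \<Rightarrow> (nat \<Rightarrow> nat) set" where
  "profiles J k = (\<Pi>\<^sub>E j\<in>J. strategies k j)"

definition coset_weights :: "nat \<Rightarrow> (nat \<Rightarrow> nat) \<Rightarrow> (nat \<Rightarrow> (nat \<Rightarrow> nat) \<Rightarrow> real) \<Rightarrow> bool" where
  "coset_weights n k w \<longleftrightarrow> (\<forall>i\<in>{1..n}. \<forall>t\<in>profiles ({1..n} - {i}) k. w i t > 0)"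


section \<open>Kronecker products and structure vectors\<close>

definition kron :: "real mat \<Rightarrow> real mat \<Rightarrow> real mat" (infixl "\<otimes>\<^sub>K" 70) where
  "A \<otimes>\<^sub>K B = mat (dim_row A * dim_row B) (dim_col A * dim_col B)
     (\<lambda>(r, s). A $$ (r div dim_row B, s div dim_col B) * B $$ (r mod dim_row B, s mod dim_col B))"

definition kron_list :: "real mat list \<Rightarrow> real mat" where
  "kron_list As = foldr (\<otimes>\<^sub>K) As (1\<^sub>m 1)"

text \<open>The \<open>r\<close>-th column of the identity matrix, counted from 1, as an \<open>m \<times> 1\<close> matrix.\<close>

definition delta :: "nat \<Rightarrow> nat \<Rightarrow> real mat" where
  "delta m r = mat_of_cols m [col (1\<^sub>m m) (r - 1)]"

definition profile_col :: "nat set \<Rightarrow> (nat \<Rightarrow> nat) \<Rightarrow> (nat \<Rightarrow> nat) \<Rightarrow> real mat" where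
  "profile_col J k s = kron_list (map (\<lambda>j. delta (k j) (s j)) (sorted_list_of_set J))"

text \<open>
  The row vector \<open>V\<close>, as a matrix with one row, that represents \<open>f\<close>. It exists and is unique:
  see \<open>ex1_structure_vector\<close> below. Both \<open>V\<^sub>i\<^sup>c\<close> (with \<open>J = {1..n}\<close>) and \<open>V\<^sub>i\<^sup>w\<close>
  (with \<open>J = {1..n} - {i}\<close>) are instances.
\<close>

definition structure_vector :: "nat set \<Rightarrow> (nat \<Rightarrow> nat) \<Rightarrow> ((nat \<Rightarrow> nat) \<Rightarrow> real) \<Rightarrow> real mat" where
  "structure_vector J k f =
     (THE V. V \<in> carrier_mat 1 (\<Prod>j\<in>J. k j) \<and>
        (\<forall>s\<in>profiles J k. f s = (V * profile_col J k s) $$ (0, 0)))"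

text \<open>
  \<open>V\<^sub>G\<close> is a library vector, which has no row or column orientation, so it also stands
  for its own transpose.
\<close>

definition game_vector :: "nat \<Rightarrow> (nat \<Rightarrow> nat) \<Rightarrow> (nat \<Rightarrow> (nat \<Rightarrow> nat) \<Rightarrow> real) \<Rightarrow> real vec" where
  "game_vector n k c =
     foldr (\<lambda>i v. row (structure_vector {1..n} k (c i)) 0 @\<^sub>v v) [1..<n + 1] (0\<^sub>v 0)"


section \<open>The coset weighted pure potential subspace\<close>

definition num_profiles :: "nat \<Rightarrow> (nat \<Rightarrow> nat) \<Rightarrow> nat" where
  "num_profiles n k = (\<Prod>j\<in>{1..n}. k j)"

definition E_mat :: "nat \<Rightarrow> (nat \<Rightarrow> nat) \<Rightarrow> nat \<Rightarrow> real mat" where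
  "E_mat n k i =
     1\<^sub>m (\<Prod>j\<in>{1..<i}. k j) \<otimes>\<^sub>K mat (k i) 1 (\<lambda>_. 1) \<otimes>\<^sub>K 1\<^sub>m (\<Prod>j\<in>{i<..n}. k j)"

definition Lambda_mat ::
    "nat \<Rightarrow> (nat \<Rightarrow> nat) \<Rightarrow> (nat \<Rightarrow> (nat \<Rightarrow> nat) \<Rightarrow> real) \<Rightarrow> nat \<Rightarrow> real mat" where
  "Lambda_mat n k w i =
     mat_diag (num_profiles n k)
       (\<lambda>r. (structure_vector ({1..n} - {i}) k (w i) * (E_mat n k i)\<^sup>T) $$ (0, r))"

definition B_block ::
    "nat \<Rightarrow> (nat \<Rightarrow> nat) \<Rightarrow> (nat \<Rightarrow> (nat \<Rightarrow> nat) \<Rightarrow> real) \<Rightarrow> nat \<Rightarrow> real mat" where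
  "B_block n k w i =
     Lambda_mat n k w i -
     (1 / real (k i)) \<cdot>\<^sub>m (Lambda_mat n k w i * E_mat n k i * (E_mat n k i)\<^sup>T)"

definition B_mat ::
    "nat \<Rightarrow> (nat \<Rightarrow> nat) \<Rightarrow> (nat \<Rightarrow> (nat \<Rightarrow> nat) \<Rightarrow> real) \<Rightarrow> real mat" where
  "B_mat n k w =
     foldr (@\<^sub>r) (map (B_block n k w) [1..<n + 1]) (0\<^sub>m 0 (num_profiles n k))"

definition pure_potential_subspace ::
    "nat \<Rightarrow> (nat \<Rightarrow> nat) \<Rightarrow> (nat \<Rightarrow> (nat \<Rightarrow> nat) \<Rightarrow> real) \<Rightarrow> real vec set" where
  "pure_potential_subspace n k w =
     vec_space.col_space (n * num_profiles n k) (B_mat n k w)"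

definition coset_weighted_pure_potential_game ::
    "nat \<Rightarrow> (nat \<Rightarrow> nat) \<Rightarrow> (nat \<Rightarrow> (nat \<Rightarrow> nat) \<Rightarrow> real) \<Rightarrow> bool" where
  "coset_weighted_pure_potential_game n k c \<longleftrightarrow>
     (\<exists>w. coset_weights n k w \<and> game_vector n k c \<in> pure_potential_subspace n k w)"


section \<open>Existence and uniqueness of structure vectors\<close>

fun profile_index :: "(nat \<Rightarrow> nat) \<Rightarrow> nat list \<Rightarrow> (nat \<Rightarrow> nat) \<Rightarrow> nat" where
  "profile_index k [] s = 0"
| "profile_index k (j # js) s = (s j - 1) * prod_list (map k js) + profile_index k js s"

lemma delta_carrier [simp]: "delta m r \<in> carrier_mat m 1"
  unfolding delta_def carrier_mat_def by simp

lemma delta_index [simp]: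
  assumes "a < m" "1 \<le> r" "r \<le> m"
  shows "delta m r $$ (a, 0) = (if a = r - 1 then 1 else 0)"
  using assms by (auto simp: delta_def mat_of_cols_index)

lemma profile_index_less:
  assumes "\<And>j. j \<in> set js \<Longrightarrow> s j \<in> strategies k j"
  shows "profile_index k js s < prod_list (map k js)"
  using assms
proof (induction js)
  case (Cons j js)
  let ?p = "prod_list (map k js)"
  have l: "profile_index k js s < ?p" using Cons by auto
  have "s j - 1 < k j" using Cons.prems[of j] by (auto simp: strategies_def)
  hence "(s j - 1) * ?p + ?p \<le> k j * ?p"
    by (metis Suc_leI add.commute mult_Suc mult_le_mono1)
  with l show ?case by simp
qed simp

lemma kron_list_delta:
  assumes "\<And>j. j \<in> set js \<Longrightarrow> s j \<in> strategies k j"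
  shows "kron_list (map (\<lambda>j. delta (k j) (s j)) js) =
    delta (prod_list (map k js)) (Suc (profile_index k js s))"
  using assms
proof (induction js)
  case Nil
  show ?case by (rule eq_matI) (auto simp: kron_list_def delta_def mat_of_cols_index)
next
  case (Cons j js)
  let ?p = "prod_list (map k js)" and ?i = "profile_index k js s"
  have l: "?i < ?p" using profile_index_less[of js s k] Cons.prems by auto
  have sj: "1 \<le> s j" "s j \<le> k j" using Cons.prems[of j] by (auto simp: strategies_def)
  have l2: "profile_index k (j # js) s < k j * ?p"
    using profile_index_less[of "j # js" s k] Cons.prems by auto
  have IH: "kron_list (map (\<lambda>j. delta (k j) (s j)) js) = delta ?p (Suc ?i)"
    using Cons by auto
  have "delta (k j) (s j) \<otimes>\<^sub>K delta ?p (Suc ?i)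
     = delta (k j * ?p) (Suc (profile_index k (j # js) s))" (is "?L = ?R")
  proof (rule eq_matI)
    fix a b assume "a < dim_row ?R" "b < dim_col ?R"
    hence a: "a < k j * ?p" and b: "b = 0" by (auto simp: delta_def)
    have p: "?p > 0" using l by simp
    have d: "a div ?p < k j" "a mod ?p < ?p"
      using a p by (auto simp: less_mult_imp_div_less)
    have e: "a = (s j - 1) * ?p + ?i \<longleftrightarrow> a div ?p = s j - 1 \<and> a mod ?p = ?i"
      using l by (metis div_mult_mod_eq div_mult_self3 add.commute div_less add_0
          mod_mult_self3 mod_less gr_implies_not0)
    have L: "?L $$ (a, b) = delta (k j) (s j) $$ (a div ?p, 0) * delta ?p (Suc ?i) $$ (a mod ?p, 0)"
      using a b unfolding kron_def by (simp add: delta_def)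
    have R: "?R $$ (a, b) = (if a = (s j - 1) * ?p + ?i then 1 else 0)"
      using a b l2 by (subst b, subst delta_index) auto
    show "?L $$ (a, b) = ?R $$ (a, b)"
      unfolding L R e using d sj l by (simp add: Suc_le_eq)
  qed (auto simp: kron_def delta_def)
  thus ?case using IH by (simp add: kron_list_def)
qed

lemma profile_index_inj:
  assumes "\<And>j. j \<in> set js \<Longrightarrow> s j \<in> strategies k j" "\<And>j. j \<in> set js \<Longrightarrow> t j \<in> strategies k j"
    and "profile_index k js s = profile_index k js t" "j \<in> set js"
  shows "s j = t j"
  using assms
proof (induction js)
  case (Cons l js)
  let ?p = "prod_list (map k js)"
  have i: "profile_index k js s < ?p" "profile_index k js t < ?p"
    using profile_index_less[of js s k] profile_index_less[of js t k] Cons.prems by auto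
  have eq: "(s l - 1) * ?p + profile_index k js s = (t l - 1) * ?p + profile_index k js t"
    using Cons.prems(3) by simp
  have "profile_index k js s = profile_index k js t"
    using arg_cong[OF eq, of "\<lambda>x. x mod ?p"] i by simp
  moreover have "s l - 1 = t l - 1"
    using eq i calculation by (metis add_right_cancel mult_right_cancel not_less0)
  hence "s l = t l"
    using Cons.prems(1,2)[of l] by (auto simp: strategies_def)
  ultimately show ?case using Cons by auto
qed simp

lemma ex1_structure_vector:
  assumes "finite J"
  shows "\<exists>!V. V \<in> carrier_mat 1 (\<Prod>j\<in>J. k j) \<and>
    (\<forall>s\<in>profiles J k. f s = (V * profile_col J k s) $$ (0, 0))"
proof -
  define js where "js = sorted_list_of_set J"
  have js: "set js = J" "distinct js" using assms by (auto simp: js_def)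
  define p where "p = (\<Prod>j\<in>J. k j)"
  have p: "prod_list (map k js) = p"
    using prod.distinct_set_conv_list[OF js(2), of k] js(1) by (simp add: p_def)
  let ?ix = "profile_index k js"
  have mem: "s j \<in> strategies k j" if "s \<in> profiles J k" "j \<in> set js" for s j
    using that js by (auto simp: profiles_def PiE_mem)
  have less: "?ix s < p" if "s \<in> profiles J k" for s
    using profile_index_less[of js s k] mem[OF that] p by auto
  have inj: "inj_on ?ix (profiles J k)"
  proof (rule inj_onI)
    fix s t assume s: "s \<in> profiles J k" and t: "t \<in> profiles J k" and e: "?ix s = ?ix t"
    have "s j = t j" if "j \<in> J" for j
      using profile_index_inj[of js s k t j] mem[OF s] mem[OF t] e that js by auto
    with s t show "s = t" unfolding profiles_def by (rule PiE_ext)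
  qed
  have "card (profiles J k) = p"
    using assms by (simp add: profiles_def card_PiE strategies_def p_def)
  hence "card (?ix ` profiles J k) = card {..<p}" using inj by (simp add: card_image)
  hence bij: "?ix ` profiles J k = {..<p}" using less by (intro card_subset_eq) auto
  have ent: "(V * profile_col J k s) $$ (0, 0) = V $$ (0, ?ix s)"
    if V: "V \<in> carrier_mat 1 p" and s: "s \<in> profiles J k" for V s
  proof -
    have "profile_col J k s = delta p (Suc (?ix s))"
      unfolding profile_col_def js_def[symmetric]
      using kron_list_delta[of js s k] mem[OF s] p by simp
    moreover have "(V * delta p (Suc (?ix s))) $$ (0, 0)
        = (\<Sum>a<p. V $$ (0, a) * delta p (Suc (?ix s)) $$ (a, 0))"
      using V delta_carrier[of p "Suc (?ix s)"]
      by (auto simp: scalar_prod_def lessThan_atLeast0 intro!: sum.cong)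
    moreover have "\<dots> = (\<Sum>a<p. if a = ?ix s then V $$ (0, a) else 0)"
      using less[OF s] by (intro sum.cong) (auto simp: Suc_le_eq)
    ultimately show ?thesis using less[OF s] by simp
  qed
  define V where "V = mat 1 p (\<lambda>(_, a). f (the_inv_into (profiles J k) ?ix a))"
  have V: "V \<in> carrier_mat 1 p" by (simp add: V_def)
  show ?thesis unfolding p_def[symmetric]
  proof (intro ex1I[of _ V] conjI ballI V)
    fix s assume s: "s \<in> profiles J k"
    show "f s = (V * profile_col J k s) $$ (0, 0)"
      unfolding ent[OF V s] using less[OF s] inj s by (simp add: V_def the_inv_into_f_f)
  next
    fix W
    assume W: "W \<in> carrier_mat 1 p \<and> (\<forall>s\<in>profiles J k. f s = (W * profile_col J k s) $$ (0, 0))"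
    show "W = V"
    proof (rule eq_matI)
      fix a b assume "a < dim_row V" "b < dim_col V"
      hence a: "a = 0" and b: "b < p" using V by auto
      from b bij obtain s where s: "s \<in> profiles J k" "b = ?ix s" by blast
      show "W $$ (a, b) = V $$ (a, b)"
        using W ent[OF _ s(1)] s inj b by (auto simp: a V_def the_inv_into_f_f)
    qed (use W V in auto)
  qed
qed

end

theory Submission
  imports Defs
begin

text \<open>
  In the coordinates given by numbering profiles lexicographically, \<open>E\<^sub>i\<^sup>T\<close> sums a vector over
  the coset of \<open>s\<^sub>-\<^sub>i\<close> and \<open>E\<^sub>i\<close> copies a function of \<open>s\<^sub>-\<^sub>i\<close> to all profiles of the coset. Hence,
  if \<open>v\<close> is the coordinate vector of \<open>P\<close>, the \<open>i\<close>-th block of \<open>B v\<close> is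
  \<open>w\<^sub>i\<close> times \<open>P\<close> minus its mean over the coset, and membership of the game vector in the column
  span is (2). Condition (3) says the same, since a function on a coset is determined by its
  differences and its sum. The mean carries the factor \<open>1 / k\<^sub>i\<close> that is missing from (2) as
  stated informally.
\<close>

text \<open>Players and strategies are numbered from 1, so \<open>{1..n}\<close> and
  \<open>[1..<i]\<close> must not be rewritten to forms with \<open>Suc 0\<close>.\<close>

declare One_nat_def [simp del]

section \<open>Enumerating profiles\<close>

abbreviation profile_number :: "nat set \<Rightarrow> (nat \<Rightarrow> nat) \<Rightarrow> (nat \<Rightarrow> nat) \<Rightarrow> nat" where
  "profile_number J k \<equiv> profile_index k (sorted_list_of_set J)"

lemma prod_list_sorted_list_of_set:
  "finite J \<Longrightarrow> prod_list (map k (sorted_list_of_set J)) = (\<Prod>j\<in>J. k j)"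
  for k :: "nat \<Rightarrow> nat"
  using prod.distinct_set_conv_list[of "sorted_list_of_set J" k] by simp

lemma profile_number_less:
  assumes "finite J" "s \<in> profiles J k"
  shows "profile_number J k s < (\<Prod>j\<in>J. k j)"
  using profile_index_less[of "sorted_list_of_set J" s k] assms
  by (auto simp: profiles_def prod_list_sorted_list_of_set PiE_mem)

text \<open>Surjectivity comes from counting: the numbering is injective, and there are as many
  profiles as numbers below the bound.\<close>

lemma bij_betw_profile_number:
  assumes "finite J"
  shows "bij_betw (profile_number J k) (profiles J k) {..<\<Prod>j\<in>J. k j}"
proof -
  have inj: "inj_on (profile_number J k) (profiles J k)"
  proof (rule inj_onI)
    fix s t assume s: "s \<in> profiles J k" and t: "t \<in> profiles J k"
      and e: "profile_number J k s = profile_number J k t"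
    have "s j = t j" if "j \<in> J" for j
      using profile_index_inj[of "sorted_list_of_set J" s k t j] assms s t e that
      by (auto simp: profiles_def PiE_mem)
    with s t show "s = t" unfolding profiles_def by (rule PiE_ext)
  qed
  have "card (profiles J k) = (\<Prod>j\<in>J. k j)"
    using assms by (simp add: profiles_def card_PiE strategies_def)
  hence "card (profile_number J k ` profiles J k) = card {..<\<Prod>j\<in>J. k j}"
    using inj by (simp add: card_image)
  hence "profile_number J k ` profiles J k = {..<\<Prod>j\<in>J. k j}"
    using profile_number_less[OF assms] by (intro card_subset_eq) auto
  with inj show ?thesis by (simp add: bij_betw_def)
qed

lemma finite_profiles: "finite J \<Longrightarrow> finite (profiles J k)"
  by (simp add: profiles_def finite_PiE strategies_def)

lemma sum_profile_number:
  assumes "finite J"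
  shows "(\<Sum>r<(\<Prod>j\<in>J. k j). g r) = (\<Sum>s\<in>profiles J k. g (profile_number J k s))"
  by (rule sum.reindex_bij_betw[OF bij_betw_profile_number[OF assms], symmetric])

text \<open>Every index is the number of some profile, so vectors can be handled as functions on
  profiles and raw indices disappear from later arguments.\<close>

lemma eq_vec_profiles:
  assumes "finite J" "u \<in> carrier_vec (\<Prod>j\<in>J. k j)" "v \<in> carrier_vec (\<Prod>j\<in>J. k j)"
  shows "u = v \<longleftrightarrow> (\<forall>s\<in>profiles J k. u $ profile_number J k s = v $ profile_number J k s)"
proof
  assume eq: "\<forall>s\<in>profiles J k. u $ profile_number J k s = v $ profile_number J k s"
  show "u = v"
  proof (rule eq_vecI)
    fix r assume "r < dim_vec v"
    hence "r \<in> profile_number J k ` profiles J k"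
      using assms bij_betw_imp_surj_on[OF bij_betw_profile_number[OF assms(1), of k]] by auto
    thus "u $ r = v $ r" using eq by auto
  qed (use assms in auto)
qed simp

lemma mult_mat_vec_profiles:
  assumes "finite J" "M \<in> carrier_mat m (\<Prod>j\<in>J. k j)" "v \<in> carrier_vec (\<Prod>j\<in>J. k j)" "r < m"
  shows "(M *\<^sub>v v) $ r =
    (\<Sum>t\<in>profiles J k. M $$ (r, profile_number J k t) * v $ profile_number J k t)"
  using assms sum_profile_number[OF assms(1), of "\<lambda>a. M $$ (r, a) * v $ a" k]
  by (simp add: scalar_prod_def lessThan_atLeast0[symmetric])

text \<open>The index is a mixed-radix numeral with the most significant digit first, so leading
  digits are shifted by the product of the trailing radices.\<close>

lemma profile_index_append:
  "profile_index k (xs @ ys) s = profile_index k xs s * prod_list (map k ys) + profile_index k ys s"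
  by (induction xs) (auto simp: algebra_simps)

lemma profile_number_eq_iff:
  assumes "finite J" "s \<in> profiles J k" "t \<in> profiles J k"
  shows "profile_number J k s = profile_number J k t \<longleftrightarrow> s = t"
  using bij_betw_imp_inj_on[OF bij_betw_profile_number[OF assms(1)]] assms(2,3)
  by (auto simp: inj_on_def)

lemma profile_index_cong:
  "(\<And>j. j \<in> set js \<Longrightarrow> s j = t j) \<Longrightarrow> profile_index k js s = profile_index k js t"
  by (induction js) auto

section \<open>Structure vectors\<close>

text \<open>Multiplying by the column of a profile selects one entry of the row, so a structure
  vector is the table of values in lexicographic order.\<close>

lemma structure_vector_props:
  assumes "finite J"
  shows "structure_vector J k f \<in> carrier_mat 1 (\<Prod>j\<in>J. k j)"
    and "s \<in> profiles J k \<Longrightarrow> structure_vector J k f $$ (0, profile_number J k s) = f s"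
proof -
  let ?V = "structure_vector J k f" and ?p = "\<Prod>j\<in>J. k j"
  have V: "?V \<in> carrier_mat 1 ?p \<and>
      (\<forall>s\<in>profiles J k. f s = (?V * profile_col J k s) $$ (0, 0))"
    unfolding structure_vector_def by (rule theI'[OF ex1_structure_vector[OF assms]])
  thus c: "?V \<in> carrier_mat 1 ?p" by blast
  assume s: "s \<in> profiles J k"
  let ?r = "profile_number J k s"
  have r: "?r < ?p" using profile_number_less[OF assms s] .
  \<comment> \<open>A Kronecker product of unit columns is a unit column. The \<open>Suc\<close> is
    there because \<open>delta\<close> counts from 1 and profile numbers start at 0.\<close>
  have "profile_col J k s = delta ?p (Suc ?r)"
    using kron_list_delta[of "sorted_list_of_set J" s k] assms s
    by (auto simp: profile_col_def prod_list_sorted_list_of_set profiles_def PiE_mem)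
  hence "f s = (?V * delta ?p (Suc ?r)) $$ (0, 0)" using V s by simp
  also have "\<dots> = (\<Sum>a<?p. ?V $$ (0, a) * delta ?p (Suc ?r) $$ (a, 0))"
    using c delta_carrier[of ?p "Suc ?r"]
    by (auto simp: One_nat_def scalar_prod_def lessThan_atLeast0 intro!: sum.cong)
  also have "\<dots> = (\<Sum>a<?p. if a = ?r then ?V $$ (0, a) else 0)"
    using r by (intro sum.cong) (auto simp: Suc_le_eq)
  finally show "?V $$ (0, ?r) = f s" using r by simp
qed

section \<open>The blocks of the potential matrix\<close>

text \<open>The split isolates the digit of player \<open>i\<close> between a leading and a trailing
  block, matching the three Kronecker factors of \<open>E_mat\<close>.\<close>

lemma sorted_list_players_split:
  assumes "i \<in> {1..n::nat}"
  shows "sorted_list_of_set {1..n} = [1..<i] @ i # [Suc i..<Suc n]"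
    and "sorted_list_of_set ({1..n} - {i}) = [1..<i] @ [Suc i..<Suc n]"
proof -
  have "{1..n} = {1..<Suc n}" by auto
  hence "sorted_list_of_set {1..n} = [1..<Suc n]" by (simp only: sorted_list_of_set_range)
  also have "\<dots> = [1..<i] @ i # [Suc i..<Suc n]"
    using assms upt_add_eq_append[of 1 i "Suc n - i"] by (auto simp: upt_conv_Cons)
  finally show *: "sorted_list_of_set {1..n} = [1..<i] @ i # [Suc i..<Suc n]" .
  show "sorted_list_of_set ({1..n} - {i}) = [1..<i] @ [Suc i..<Suc n]"
    by (simp only: sorted_list_of_set_remove[OF finite_atLeastAtMost] *) (simp add: remove1_append)
qed

lemma num_profiles_remove:
  assumes "i \<in> {1..n}"
  shows "(\<Prod>j\<in>{1..n} - {i}. k j) = (\<Prod>j\<in>{1..<i}. k j) * (\<Prod>j\<in>{i<..n}. k j)"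
    and "num_profiles n k = (\<Prod>j\<in>{1..<i}. k j) * k i * (\<Prod>j\<in>{i<..n}. k j)"
proof -
  have split: "{1..n} - {i} = {1..<i} \<union> {i<..n}" using assms by auto
  show *: "(\<Prod>j\<in>{1..n} - {i}. k j) = (\<Prod>j\<in>{1..<i}. k j) * (\<Prod>j\<in>{i<..n}. k j)"
    unfolding split by (rule prod.union_disjoint) auto
  show "num_profiles n k = (\<Prod>j\<in>{1..<i}. k j) * k i * (\<Prod>j\<in>{i<..n}. k j)"
    using assms prod.remove[of "{1..n}" i k] * by (simp add: num_profiles_def)
qed

lemma E_mat_carrier:
  assumes "i \<in> {1..n}"
  shows "E_mat n k i \<in> carrier_mat (num_profiles n k) (\<Prod>j\<in>{1..n} - {i}. k j)"
  unfolding num_profiles_remove[OF assms] by (simp add: E_mat_def kron_def)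

section \<open>Splitting a profile into one strategy and its coset, and the entries of
  \<open>E_mat\<close>\<close>

lemma restrict_profile:
  assumes "s \<in> profiles {1..n} k"
  shows "restrict s ({1..n} - {i}) \<in> profiles ({1..n} - {i}) k"
  using assms by (auto simp: profiles_def PiE_mem)

lemma profile_upd:
  assumes "i \<in> {1..n}" "t \<in> profiles ({1..n} - {i}) k" "x \<in> strategies k i"
  shows "t(i := x) \<in> profiles {1..n} k" "restrict (t(i := x)) ({1..n} - {i}) = t"
  using assms by (auto simp: profiles_def PiE_iff extensional_def restrict_def fun_eq_iff)

lemma profile_decomp:
  assumes "i \<in> {1..n}" "s \<in> profiles {1..n} k"
  shows "(restrict s ({1..n} - {i}))(i := s i) = s" "s i \<in> strategies k i"
  using assms by (auto simp: profiles_def PiE_iff extensional_def restrict_def fun_eq_iff)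

lemma mult_add_eq_iff:
  fixes x y b :: nat
  assumes "p < b" "q < b"
  shows "x * b + p = y * b + q \<longleftrightarrow> x = y \<and> p = q"
proof
  assume eq: "x * b + p = y * b + q"
  have "(x * b + p) div b = x" "(y * b + q) div b = y" using assms by simp_all
  with eq show "x = y \<and> p = q" by simp
qed simp

text \<open>\<open>E_mat\<close> is the incidence matrix of profiles and cosets. The outer identity
  factors compare the digits before and after player \<open>i\<close>, while the all-ones column
  ignores the digit of player \<open>i\<close> itself.\<close>

lemma E_mat_index:
  assumes i: "i \<in> {1..n}" and s: "s \<in> profiles {1..n} k" and t: "t \<in> profiles ({1..n} - {i}) k"
  shows "E_mat n k i $$ (profile_number {1..n} k s, profile_number ({1..n} - {i}) k t) =
    (if restrict s ({1..n} - {i}) = t then 1 else 0)"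
proof -
  let ?J = "{1..n} - {i}" and ?ix = "profile_index k"
  let ?r = "profile_number {1..n} k s" and ?q = "profile_number ?J k t"
  define xs where "xs = [1..<i]"
  define ys where "ys = [Suc i..<Suc n]"
  note split = sorted_list_players_split[OF i, folded xs_def ys_def]
  have dist: "distinct xs" "distinct ys" by (simp_all add: xs_def ys_def)
  have sets: "set xs = {1..<i}" "set ys = {i<..n}" by (auto simp: xs_def ys_def)
  define a where "a = (\<Prod>j\<in>{1..<i}. k j)"
  define b where "b = (\<Prod>j\<in>{i<..n}. k j)"
  have a: "prod_list (map k xs) = a"
    using prod.distinct_set_conv_list[OF dist(1), of k] by (simp add: a_def sets)
  have b: "prod_list (map k ys) = b"
    using prod.distinct_set_conv_list[OF dist(2), of k] by (simp add: b_def sets)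
  have mem: "\<And>j. j \<in> set xs \<Longrightarrow> s j \<in> strategies k j" "\<And>j. j \<in> set ys \<Longrightarrow> s j \<in> strategies k j"
    "\<And>j. j \<in> set xs \<Longrightarrow> t j \<in> strategies k j" "\<And>j. j \<in> set ys \<Longrightarrow> t j \<in> strategies k j"
    using i s t by (auto simp: profiles_def PiE_iff sets)
  have less: "?ix xs s < a" "?ix ys s < b"
    "?ix xs t < a" "?ix ys t < b"
    using profile_index_less[of xs _ k] profile_index_less[of ys _ k] mem a b by metis+
  have si: "s i - 1 < k i" using profile_decomp(2)[OF i s] by (auto simp: strategies_def)
  have r: "?r = (?ix xs s * k i + (s i - 1)) * b + ?ix ys s"
    unfolding split profile_index_append
    using b by (simp add: algebra_simps)
  have q: "?q = ?ix xs t * b + ?ix ys t"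
    unfolding split profile_index_append using b by simp
  \<comment> \<open>The restriction changes no digit that is read here, because \<open>i\<close> is
    not in \<open>?J\<close>.\<close>
  have q': "profile_number ?J k (restrict s ?J) = ?ix xs s * b + ?ix ys s"
    unfolding split profile_index_append b
    using i sets by (intro arg_cong2[of _ _ _ _ "(+)"] arg_cong2[of _ _ _ _ "(*)"] profile_index_cong) auto
  \<comment> \<open>These quotients and remainders are the indices at which the nested
    \<open>kron\<close> evaluates its factors.\<close>
  have dm: "?r div b div k i = ?ix xs s" "?r mod b = ?ix ys s"
    "?q div b = ?ix xs t" "?q mod b = ?ix ys t"
    using less si unfolding r q by simp_all
  have rl: "?r < a * k i * b" and ql: "?q < a * b"
    using profile_number_less[OF _ s] profile_number_less[OF _ t] num_profiles_remove[OF i, of k]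
    by (auto simp: a_def b_def num_profiles_def)
  have rb: "?r div b < a * k i" "?q div b < a" "?r mod b < b" "?q mod b < b"
    using rl ql less by (auto simp: less_mult_imp_div_less dm)
  have "E_mat n k i $$ (?r, ?q) = (if ?ix xs s = ?ix xs t \<and>
      ?ix ys s = ?ix ys t then 1 else 0)"
    unfolding E_mat_def a_def[symmetric] b_def[symmetric]
    using rl ql rb less si by (simp add: kron_def dm)
  \<comment> \<open>Equality of both digit blocks is equality of coset numbers, hence of cosets,
    since the numbering is injective.\<close>
  also have "?ix xs s = ?ix xs t \<and>
      ?ix ys s = ?ix ys t \<longleftrightarrow> profile_number ?J k (restrict s ?J) = ?q"
    unfolding q' q using less by (simp add: mult_add_eq_iff)
  also have "\<dots> \<longleftrightarrow> restrict s ?J = t"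
    by (rule profile_number_eq_iff) (use restrict_profile[OF s] t in auto)
  finally show ?thesis .
qed

section \<open>Action of the matrices on coordinate vectors\<close>

lemma Lambda_mat_mult_vec:
  assumes i: "i \<in> {1..n}" and s: "s \<in> profiles {1..n} k" and u: "u \<in> carrier_vec (num_profiles n k)"
  shows "(Lambda_mat n k w i *\<^sub>v u) $ profile_number {1..n} k s =
    w i (restrict s ({1..n} - {i})) * u $ profile_number {1..n} k s"
proof -
  let ?J = "{1..n} - {i}" and ?r = "profile_number {1..n} k s"
  let ?V = "structure_vector ?J k (w i)" and ?E = "E_mat n k i"
  have r: "?r < num_profiles n k"
    unfolding num_profiles_def using s by (intro profile_number_less) auto
  have V: "?V \<in> carrier_mat 1 (\<Prod>j\<in>?J. k j)" by (rule structure_vector_props) simp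
  note E = E_mat_carrier[OF i, of k]
  \<comment> \<open>Row \<open>s\<close> of \<open>E_mat\<close> has its only 1 at the coset of
    \<open>s\<close>, so the product picks out the weight of that coset.\<close>
  have "(?V * ?E\<^sup>T) $$ (0, ?r) = (\<Sum>q<(\<Prod>j\<in>?J. k j). ?V $$ (0, q) * ?E $$ (?r, q))"
    using V E r by (auto simp: scalar_prod_def lessThan_atLeast0 intro!: sum.cong)
  also have "\<dots> = (\<Sum>t\<in>profiles ?J k. if restrict s ?J = t then w i t else 0)"
    by (subst sum_profile_number, simp, intro sum.cong) (simp_all add: structure_vector_props E_mat_index[OF i s])
  also have "\<dots> = w i (restrict s ?J)"
    using restrict_profile[OF s] by (simp add: finite_profiles)
  finally have d: "(?V * ?E\<^sup>T) $$ (0, ?r) = w i (restrict s ?J)" .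
  have "(Lambda_mat n k w i *\<^sub>v u) $ ?r =
      (\<Sum>q<num_profiles n k. if ?r = q then w i (restrict s ?J) * u $ q else 0)"
  proof -
    have "(Lambda_mat n k w i *\<^sub>v u) $ ?r =
        (\<Sum>q<num_profiles n k. (if ?r = q then (?V * ?E\<^sup>T) $$ (0, q) else 0) * u $ q)"
      using r u unfolding Lambda_mat_def
      by (simp add: mat_diag_def scalar_prod_def lessThan_atLeast0 del: index_mult_mat)
    thus ?thesis by (simp only:) (intro sum.cong, auto simp: d simp del: index_mult_mat)
  qed
  thus ?thesis using r by simp
qed

lemma E_mat_mult_vec:
  assumes i: "i \<in> {1..n}" and s: "s \<in> profiles {1..n} k"
    and u: "u \<in> carrier_vec (\<Prod>j\<in>{1..n} - {i}. k j)"
  shows "(E_mat n k i *\<^sub>v u) $ profile_number {1..n} k s =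
    u $ profile_number ({1..n} - {i}) k (restrict s ({1..n} - {i}))"
proof -
  let ?J = "{1..n} - {i}" and ?r = "profile_number {1..n} k s"
  have r: "?r < num_profiles n k"
    unfolding num_profiles_def using s by (intro profile_number_less) auto
  have "(E_mat n k i *\<^sub>v u) $ ?r =
      (\<Sum>t\<in>profiles ?J k. E_mat n k i $$ (?r, profile_number ?J k t) * u $ profile_number ?J k t)"
    by (rule mult_mat_vec_profiles[OF _ E_mat_carrier[OF i] u r]) simp
  also have "\<dots> = (\<Sum>t\<in>profiles ?J k. if restrict s ?J = t then u $ profile_number ?J k t else 0)"
    by (intro sum.cong) (simp_all add: E_mat_index[OF i s])
  finally show ?thesis using restrict_profile[OF s] by (simp add: finite_profiles)
qed

text \<open>Column \<open>t\<close> of \<open>E_mat\<close> has its ones exactly at the profiles of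
  the coset \<open>t\<close>.\<close>

lemma E_mat_transpose_mult_vec:
  assumes i: "i \<in> {1..n}" and t: "t \<in> profiles ({1..n} - {i}) k"
    and v: "v \<in> carrier_vec (num_profiles n k)"
  shows "((E_mat n k i)\<^sup>T *\<^sub>v v) $ profile_number ({1..n} - {i}) k t =
    (\<Sum>x\<in>strategies k i. v $ profile_number {1..n} k (t(i := x)))"
proof -
  let ?J = "{1..n} - {i}" and ?q = "profile_number ({1..n} - {i}) k t"
  let ?r = "profile_number {1..n} k"
  have q: "?q < (\<Prod>j\<in>?J. k j)" using t by (intro profile_number_less) auto
  note E = E_mat_carrier[OF i, of k]
  have r: "?r s < num_profiles n k" if "s \<in> profiles {1..n} k" for s
    unfolding num_profiles_def using that by (intro profile_number_less) auto
  have "((E_mat n k i)\<^sup>T *\<^sub>v v) $ ?q =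
      (\<Sum>s\<in>profiles {1..n} k. (E_mat n k i)\<^sup>T $$ (?q, ?r s) * v $ ?r s)"
    using E v q unfolding num_profiles_def by (intro mult_mat_vec_profiles) auto
  also have "\<dots> = (\<Sum>s\<in>profiles {1..n} k. if restrict s ?J = t then v $ ?r s else 0)"
    using E q r by (intro sum.cong) (auto simp: E_mat_index[OF i _ t])
  also have "\<dots> = (\<Sum>s | s \<in> profiles {1..n} k \<and> restrict s ?J = t. v $ ?r s)"
    by (simp add: sum.inter_filter finite_profiles)
  \<comment> \<open>A profile of the coset \<open>t\<close> is determined by the strategy of player
    \<open>i\<close>, which gives the reindexing.\<close>
  also have "\<dots> = (\<Sum>x\<in>strategies k i. v $ ?r (t(i := x)))"
    by (rule sum.reindex_bij_witness[of _ "\<lambda>x. t(i := x)" "\<lambda>s. s i"])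
      (use profile_decomp[OF i, of _ k] profile_upd[OF i t] in auto)
  finally show ?thesis .
qed

lemma Lambda_mat_carrier: "Lambda_mat n k w i \<in> carrier_mat (num_profiles n k) (num_profiles n k)"
  by (simp add: Lambda_mat_def)

lemma B_block_carrier:
  assumes "i \<in> {1..n}"
  shows "B_block n k w i \<in> carrier_mat (num_profiles n k) (num_profiles n k)"
proof -
  have "(E_mat n k i)\<^sup>T \<in> carrier_mat (\<Prod>j\<in>{1..n} - {i}. k j) (num_profiles n k)"
    using E_mat_carrier[OF assms] by simp
  from mult_carrier_mat[OF mult_carrier_mat[OF Lambda_mat_carrier E_mat_carrier[OF assms]] this]
  show ?thesis unfolding B_block_def by (intro minus_carrier_mat smult_carrier_mat)
qed

lemma B_block_mult_vec:
  assumes i: "i \<in> {1..n}" and s: "s \<in> profiles {1..n} k"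
    and v: "v \<in> carrier_vec (num_profiles n k)"
  shows "(B_block n k w i *\<^sub>v v) $ profile_number {1..n} k s =
    w i (restrict s ({1..n} - {i})) * v $ profile_number {1..n} k s -
    w i (restrict s ({1..n} - {i})) * (1 / real (k i)) *
      (\<Sum>x\<in>strategies k i. v $ profile_number {1..n} k (s(i := x)))"
proof -
  let ?L = "Lambda_mat n k w i" and ?E = "E_mat n k i" and ?m = "num_profiles n k"
  let ?J = "{1..n} - {i}" and ?r = "profile_number {1..n} k"
  note E = E_mat_carrier[OF i, of k]
  have ET: "?E\<^sup>T \<in> carrier_mat (\<Prod>j\<in>?J. k j) ?m" using E by simp
  have L: "?L \<in> carrier_mat ?m ?m" by (rule Lambda_mat_carrier)
  have r: "?r s < ?m"
    unfolding num_profiles_def using s by (intro profile_number_less) auto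
  have M: "?L * ?E * ?E\<^sup>T \<in> carrier_mat ?m ?m" by (rule mult_carrier_mat[OF mult_carrier_mat[OF L E] ET])
  have EEv: "?E *\<^sub>v (?E\<^sup>T *\<^sub>v v) \<in> carrier_vec ?m" by (rule mult_mat_vec_carrier[OF E mult_mat_vec_carrier[OF ET v]])
  \<comment> \<open>Reassociating lets the factors act on \<open>v\<close> one at a time: sum over
    the coset, copy back to its profiles, weight.\<close>
  have "(?L * ?E * ?E\<^sup>T) *\<^sub>v v = (?L * ?E) *\<^sub>v (?E\<^sup>T *\<^sub>v v)"
    by (rule assoc_mult_mat_vec[OF mult_carrier_mat[OF L E] ET v])
  also have "\<dots> = ?L *\<^sub>v (?E *\<^sub>v (?E\<^sup>T *\<^sub>v v))"
    by (rule assoc_mult_mat_vec[OF L E mult_mat_vec_carrier[OF ET v]])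
  finally have assoc: "(?L * ?E * ?E\<^sup>T) *\<^sub>v v = ?L *\<^sub>v (?E *\<^sub>v (?E\<^sup>T *\<^sub>v v))" .
  \<comment> \<open>Outside the players both sides are \<open>undefined\<close>, by extensionality
    of \<open>s\<close>; at \<open>i\<close> the deleted value is overwritten.\<close>
  have upd: "(restrict s ?J)(i := x) = s(i := x)" for x
    using s by (auto simp: profiles_def PiE_iff extensional_def restrict_def fun_eq_iff)
  have ETv: "?E\<^sup>T *\<^sub>v v \<in> carrier_vec (\<Prod>j\<in>?J. k j)" by (rule mult_mat_vec_carrier[OF ET v])
  have smult: "(a \<cdot>\<^sub>m A *\<^sub>v v) $ ?r s = a * (A *\<^sub>v v) $ ?r s"
    if "A \<in> carrier_mat ?m ?m" for a A
    using that r v by simp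
  have "((?L * ?E * ?E\<^sup>T) *\<^sub>v v) $ ?r s =
      w i (restrict s ?J) * (\<Sum>x\<in>strategies k i. v $ ?r (s(i := x)))"
    unfolding assoc Lambda_mat_mult_vec[OF i s EEv] E_mat_mult_vec[OF i s ETv]
      E_mat_transpose_mult_vec[OF i restrict_profile[OF s] v] upd ..
  moreover have "(B_block n k w i *\<^sub>v v) $ ?r s =
      (?L *\<^sub>v v) $ ?r s - ((1 / real (k i)) \<cdot>\<^sub>m (?L * ?E * ?E\<^sup>T) *\<^sub>v v) $ ?r s"
    unfolding B_block_def
    by (subst minus_mult_distrib_mat_vec[OF L _ v]) (use M r v in auto)
  ultimately show ?thesis
    by (simp add: Lambda_mat_mult_vec[OF i s v] smult[OF M])
qed

section \<open>Membership in the column span\<close>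

lemma foldr_append_rows_carrier:
  assumes "\<And>A. A \<in> set As \<Longrightarrow> A \<in> carrier_mat m nc"
  shows "foldr (@\<^sub>r) As (0\<^sub>m 0 nc) \<in> carrier_mat (length As * m) nc"
  using assms by (induction As) auto

text \<open>Multiplication commutes with stacking rows, and since corresponding blocks have the same
  length \<open>m\<close>, equality of the stacks splits into equality of the blocks.\<close>

lemma foldr_append_rows_mult_vec_eq_iff:
  assumes "\<And>i. i \<in> set is \<Longrightarrow> A i \<in> carrier_mat m nc" "\<And>i. i \<in> set is \<Longrightarrow> g i \<in> carrier_vec m"
    and v: "v \<in> carrier_vec nc"
  shows "foldr (@\<^sub>r) (map A is) (0\<^sub>m 0 nc) *\<^sub>v v = foldr (\<lambda>i v. g i @\<^sub>v v) is (0\<^sub>v 0) \<longleftrightarrow>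
    (\<forall>i\<in>set is. A i *\<^sub>v v = g i)"
  using assms(1,2)
proof (induction "is")
  case Nil
  show ?case by (auto intro!: eq_vecI)
next
  case (Cons i "is")
  have A: "A i \<in> carrier_mat m nc" and g: "g i \<in> carrier_vec m" using Cons.prems by auto
  have R: "foldr (@\<^sub>r) (map A is) (0\<^sub>m 0 nc) \<in> carrier_mat (length (map A is) * m) nc"
    using Cons.prems by (intro foldr_append_rows_carrier) auto
  have "A i *\<^sub>v v \<in> carrier_vec m" using A v by simp
  thus ?case
    using Cons.IH Cons.prems by (simp add: mat_mult_append[OF A R v] append_vec_eq[OF _ g])
qed

lemma foldr_append_vec_carrier:
  assumes "\<And>i. i \<in> set is \<Longrightarrow> g i \<in> carrier_vec m"
  shows "foldr (\<lambda>i v. g i @\<^sub>v v) is (0\<^sub>v 0) \<in> carrier_vec (length is * m)"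
  using assms by (induction "is") auto

text \<open>The vector \<open>v\<close> of coefficients of the columns is the coordinate vector of a
  potential. The equation splits first by player, then by profile.\<close>

lemma game_vector_in_subspace_iff:
  "game_vector n k c \<in> pure_potential_subspace n k w \<longleftrightarrow>
    (\<exists>v\<in>carrier_vec (num_profiles n k). \<forall>i\<in>{1..n}. \<forall>s\<in>profiles {1..n} k.
      (B_block n k w i *\<^sub>v v) $ profile_number {1..n} k s = c i s)"
proof -
  let ?m = "num_profiles n k"
  interpret vec_space "TYPE(real)" "n * ?m" .
  define g where "g i = row (structure_vector {1..n} k (c i)) 0" for i
  have set_is: "set [1..<n + 1] = {1..n}" by auto
  have sv: "structure_vector {1..n} k (c i) \<in> carrier_mat 1 ?m" for i
    unfolding num_profiles_def by (rule structure_vector_props) simp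
  have g: "g i \<in> carrier_vec ?m" for i
    using sv[of i] by (metis g_def row_carrier carrier_matD(2))
  have g_index: "g i $ profile_number {1..n} k s = c i s" if "s \<in> profiles {1..n} k" for i s
    using that sv[of i] profile_number_less[OF _ that] structure_vector_props(2)[OF _ that]
    by (simp add: g_def num_profiles_def)
  have B: "B_mat n k w \<in> carrier_mat (n * ?m) ?m"
  proof -
    have "A \<in> carrier_mat ?m ?m" if "A \<in> set (map (B_block n k w) [1..<n + 1])" for A
      using that by (auto intro: B_block_carrier)
    from foldr_append_rows_carrier[of "map (B_block n k w) [1..<n + 1]", OF this] show ?thesis by (simp add: B_mat_def)
  qed
  have V: "game_vector n k c \<in> carrier_vec (n * ?m)"
    using foldr_append_vec_carrier[of "[1..<n + 1]" g ?m] g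
    by (simp add: game_vector_def g_def)
  \<comment> \<open>The column space consists of all products of the matrix with a vector.\<close>
  have "game_vector n k c \<in> pure_potential_subspace n k w \<longleftrightarrow>
      (\<exists>v\<in>carrier_vec ?m. B_mat n k w *\<^sub>v v = game_vector n k c)"
    unfolding pure_potential_subspace_def col_space_eq[OF B] using B V by auto
  also have "\<dots> \<longleftrightarrow> (\<exists>v\<in>carrier_vec ?m. \<forall>i\<in>{1..n}. B_block n k w i *\<^sub>v v = g i)"
  proof (rule bex_cong[OF refl])
    fix v :: "real vec" assume v: "v \<in> carrier_vec ?m"
    have B': "B_block n k w i \<in> carrier_mat ?m ?m" if "i \<in> set [1..<n + 1]" for i
      using that unfolding set_is by (rule B_block_carrier)
    have "foldr (@\<^sub>r) (map (B_block n k w) [1..<n + 1]) (0\<^sub>m 0 ?m) *\<^sub>v v =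
        foldr (\<lambda>i v. g i @\<^sub>v v) [1..<n + 1] (0\<^sub>v 0) \<longleftrightarrow>
        (\<forall>i\<in>set [1..<n + 1]. B_block n k w i *\<^sub>v v = g i)"
      by (rule foldr_append_rows_mult_vec_eq_iff[OF B' g v])
    thus "B_mat n k w *\<^sub>v v = game_vector n k c \<longleftrightarrow> (\<forall>i\<in>{1..n}. B_block n k w i *\<^sub>v v = g i)"
      unfolding B_mat_def game_vector_def g_def set_is .
  qed
  also have "\<dots> \<longleftrightarrow> (\<exists>v\<in>carrier_vec ?m. \<forall>i\<in>{1..n}. \<forall>s\<in>profiles {1..n} k.
      (B_block n k w i *\<^sub>v v) $ profile_number {1..n} k s = c i s)"
  proof (intro bex_cong ball_cong refl)
    fix v :: "real vec" and i assume v: "v \<in> carrier_vec ?m" and i: "i \<in> {1..n}"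
    have Bv: "B_block n k w i *\<^sub>v v \<in> carrier_vec ?m"
      by (rule mult_mat_vec_carrier[OF B_block_carrier[OF i] v])
    show "B_block n k w i *\<^sub>v v = g i \<longleftrightarrow> (\<forall>s\<in>profiles {1..n} k.
      (B_block n k w i *\<^sub>v v) $ profile_number {1..n} k s = c i s)"
      using eq_vec_profiles[of "{1..n}" _ k, OF _ Bv[unfolded num_profiles_def] g[unfolded num_profiles_def]]
      by (simp add: g_index)
  qed
  finally show ?thesis .
qed

section \<open>From coordinate vectors to functions on profiles\<close>

lemma ball_profiles_iff:
  assumes "i \<in> {1..n}"
  shows "(\<forall>s\<in>profiles {1..n} k. Q s) \<longleftrightarrow>
    (\<forall>t\<in>profiles ({1..n} - {i}) k. \<forall>a\<in>strategies k i. Q (t(i := a)))"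
proof (intro iffI ballI)
  fix s assume "\<forall>t\<in>profiles ({1..n} - {i}) k. \<forall>a\<in>strategies k i. Q (t(i := a))"
    and s: "s \<in> profiles {1..n} k"
  hence "Q ((restrict s ({1..n} - {i}))(i := s i))"
    using restrict_profile[OF s] profile_decomp(2)[OF assms s] by blast
  thus "Q s" by (simp only: profile_decomp(1)[OF assms s])
qed (simp add: profile_upd(1)[OF assms])

lemma coset_weighted_pure_potential_game_iff:
  "coset_weighted_pure_potential_game n k c \<longleftrightarrow>
    (\<exists>(P :: (nat \<Rightarrow> nat) \<Rightarrow> real) w. coset_weights n k w \<and>
      (\<forall>i\<in>{1..n}. \<forall>t\<in>profiles ({1..n} - {i}) k. \<forall>a\<in>strategies k i.
        c i (t(i := a)) =
          w i t * P (t(i := a)) -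
          w i t * (1 / real (k i)) * (\<Sum>x\<in>strategies k i. P (t(i := x)))))"
    (is "_ \<longleftrightarrow> (\<exists>P w. _ \<and> ?C P w)")
proof -
  let ?m = "num_profiles n k" and ?r = "profile_number {1..n} k"
  define C where "C P w \<longleftrightarrow> ?C P w" for P w
  \<comment> \<open>A coordinate vector is read as the function sending a profile to the entry at
    its number.\<close>
  have eq: "(\<forall>i\<in>{1..n}. \<forall>s\<in>profiles {1..n} k. (B_block n k w i *\<^sub>v v) $ ?r s = c i s) \<longleftrightarrow>
      C (\<lambda>s. v $ ?r s) w" if v: "v \<in> carrier_vec ?m" for v w
    unfolding C_def
  proof (rule ball_cong[OF refl])
    fix i assume i: "i \<in> {1..n}"
    show "(\<forall>s\<in>profiles {1..n} k. (B_block n k w i *\<^sub>v v) $ ?r s = c i s) \<longleftrightarrow>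
      (\<forall>t\<in>profiles ({1..n} - {i}) k. \<forall>a\<in>strategies k i. c i (t(i := a)) =
        w i t * v $ ?r (t(i := a)) -
        w i t * (1 / real (k i)) * (\<Sum>x\<in>strategies k i. v $ ?r (t(i := x))))"
      unfolding ball_profiles_iff[OF i]
      using B_block_mult_vec[OF i profile_upd(1)[OF i] v, of _ _ w] profile_upd(2)[OF i]
      by (intro ball_cong refl) auto
  qed
  \<comment> \<open>Conversely, \<open>P\<close> is tabulated in the order of the numbering. The
    table recovers \<open>P\<close> on profiles only, which suffices because \<open>C\<close>
    evaluates \<open>P\<close> only at profiles \<open>t(i := a)\<close>.\<close>
  have realize: "\<exists>v\<in>carrier_vec ?m. C (\<lambda>s. v $ ?r s) w" if CP: "C P w" for P w
  proof
    let ?v = "vec ?m (\<lambda>r. P (the_inv_into (profiles {1..n} k) ?r r))"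
    show "?v \<in> carrier_vec ?m" by simp
    have "?v $ ?r s = P s" if s: "s \<in> profiles {1..n} k" for s
      using s profile_number_less[OF _ s]
        bij_betw_imp_inj_on[OF bij_betw_profile_number[of "{1..n}" k]]
      by (simp add: num_profiles_def the_inv_into_f_f)
    thus "C (\<lambda>s. ?v $ ?r s) w"
      using CP profile_upd(1) unfolding C_def by simp
  qed
  have "game_vector n k c \<in> pure_potential_subspace n k w \<longleftrightarrow> (\<exists>P. C P w)" for w
    unfolding game_vector_in_subspace_iff
  proof
    assume "\<exists>v\<in>carrier_vec ?m. \<forall>i\<in>{1..n}. \<forall>s\<in>profiles {1..n} k.
      (B_block n k w i *\<^sub>v v) $ ?r s = c i s"
    then obtain v where "v \<in> carrier_vec ?m" "\<forall>i\<in>{1..n}. \<forall>s\<in>profiles {1..n} k.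
      (B_block n k w i *\<^sub>v v) $ ?r s = c i s" ..
    hence "C (\<lambda>s. v $ ?r s) w" using eq by simp
    thus "\<exists>P. C P w" by (rule exI[of "\<lambda>P. C P w" "\<lambda>s. v $ ?r s"])
  next
    assume "\<exists>P. C P w"
    then obtain P where "C P w" ..
    then obtain v where "v \<in> carrier_vec ?m" "C (\<lambda>s. v $ ?r s) w"
      using realize by blast
    thus "\<exists>v\<in>carrier_vec ?m. \<forall>i\<in>{1..n}. \<forall>s\<in>profiles {1..n} k.
      (B_block n k w i *\<^sub>v v) $ ?r s = c i s"
      using eq by (intro bexI[of _ v]) simp_all
  qed
  thus ?thesis
    unfolding coset_weighted_pure_potential_game_def C_def[symmetric] by blast
qed

section \<open>Centred functions and differences on a single coset\<close>

text \<open>Subtracting the mean makes the sum vanish and leaves differences unchanged; conversely,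
  the sum and the differences determine a function on a finite nonempty set.\<close>

lemma centred_iff_differences:
  fixes f g :: "nat \<Rightarrow> real"
  assumes "finite A" "A \<noteq> {}"
  shows "(\<forall>a\<in>A. f a = w * g a - w * (1 / real (card A)) * (\<Sum>x\<in>A. g x)) \<longleftrightarrow>
    (\<forall>x\<in>A. \<forall>y\<in>A. (\<Sum>z\<in>A. f z) = 0 \<and> f x - f y = w * (g x - g y))"
    (is "?L \<longleftrightarrow> ?R")
proof -
  have card: "real (card A) > 0" using assms by (simp add: card_gt_0_iff)
  show ?thesis
  proof
    assume L: ?L
    have "(\<Sum>z\<in>A. f z) = (\<Sum>z\<in>A. w * g z - w * (1 / real (card A)) * (\<Sum>x\<in>A. g x))"
      by (intro sum.cong) (use L in auto)
    also have "\<dots> = 0"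
      using card by (simp add: sum_subtractf flip: sum_distrib_left)
    finally show ?R
      using L by (auto simp: right_diff_distrib)
  next
    assume R: ?R
    show ?L
    proof
      fix a assume a: "a \<in> A"
      \<comment> \<open>Averaging the differences over \<open>y\<close> isolates \<open>f a\<close>,
        because the values of \<open>f\<close> sum to zero.\<close>
      have "(\<Sum>y\<in>A. f a - f y) = (\<Sum>y\<in>A. w * (g a - g y))"
        using R a by (intro sum.cong) auto
      moreover have "(\<Sum>z\<in>A. f z) = 0" using R a by blast
      ultimately have "real (card A) * f a = w * (real (card A) * g a - (\<Sum>y\<in>A. g y))"
        by (simp add: sum_subtractf right_diff_distrib sum_distrib_left mult.left_commute)
      thus "f a = w * g a - w * (1 / real (card A)) * (\<Sum>x\<in>A. g x)"
        using card by (simp add: field_simps)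
    qed
  qed
qed

theorem theorem15:
  fixes n :: nat
    and k :: "nat \<Rightarrow> nat"
    and c :: "nat \<Rightarrow> (nat \<Rightarrow> nat) \<Rightarrow> real"
  assumes "\<And>i. i \<in> {1..n} \<Longrightarrow> k i \<ge> 2"
  shows
    "(coset_weighted_pure_potential_game n k c \<longleftrightarrow>
      (\<exists>(P :: (nat \<Rightarrow> nat) \<Rightarrow> real) w. coset_weights n k w \<and>
        (\<forall>i\<in>{1..n}. \<forall>t\<in>profiles ({1..n} - {i}) k. \<forall>a\<in>strategies k i.
          c i (t(i := a)) =
            w i t * P (t(i := a)) -
            w i t * (1 / real (k i)) * (\<Sum>x\<in>strategies k i. P (t(i := x)))))) \<and>
     (coset_weighted_pure_potential_game n k c \<longleftrightarrow>
      (\<exists>(P :: (nat \<Rightarrow> nat) \<Rightarrow> real) w. coset_weights n k w \<and>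
        (\<forall>i\<in>{1..n}. \<forall>t\<in>profiles ({1..n} - {i}) k.
          \<forall>x\<in>strategies k i. \<forall>y\<in>strategies k i.
            (\<Sum>z\<in>strategies k i. c i (t(i := z))) = 0 \<and>
            c i (t(i := x)) - c i (t(i := y)) = w i t * (P (t(i := x)) - P (t(i := y))))))"
proof -
  \<comment> \<open>With player and coset fixed, only functions of the player's own strategy remain.
    The bound on \<open>k i\<close> makes the strategy set nonempty, and its cardinality
    \<open>k i\<close> supplies the factor in the mean.\<close>
  have pointwise: "(\<forall>a\<in>strategies k i. c i (t(i := a)) =
          w i t * P (t(i := a)) -
          w i t * (1 / real (k i)) * (\<Sum>x\<in>strategies k i. P (t(i := x)))) \<longleftrightarrow>
        (\<forall>x\<in>strategies k i. \<forall>y\<in>strategies k i.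
            (\<Sum>z\<in>strategies k i. c i (t(i := z))) = 0 \<and>
            c i (t(i := x)) - c i (t(i := y)) = w i t * (P (t(i := x)) - P (t(i := y))))"
    if "i \<in> {1..n}" for i t w and P :: "(nat \<Rightarrow> nat) \<Rightarrow> real"
    using centred_iff_differences[of "strategies k i" "\<lambda>x. c i (t(i := x))" "w i t" "\<lambda>x. P (t(i := x))"]
      assms[OF that] by (simp add: strategies_def)
  \<comment> \<open>The same \<open>P\<close> and \<open>w\<close> serve both conditions, so the
    equivalence can be rewritten under the existential quantifiers.\<close>
  have eq: "(\<forall>i\<in>{1..n}. \<forall>t\<in>profiles ({1..n} - {i}) k. \<forall>a\<in>strategies k i.
          c i (t(i := a)) =
            w i t * P (t(i := a)) -
            w i t * (1 / real (k i)) * (\<Sum>x\<in>strategies k i. P (t(i := x)))) \<longleftrightarrow>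
        (\<forall>i\<in>{1..n}. \<forall>t\<in>profiles ({1..n} - {i}) k.
          \<forall>x\<in>strategies k i. \<forall>y\<in>strategies k i.
            (\<Sum>z\<in>strategies k i. c i (t(i := z))) = 0 \<and>
            c i (t(i := x)) - c i (t(i := y)) = w i t * (P (t(i := x)) - P (t(i := y))))"
    for w and P :: "(nat \<Rightarrow> nat) \<Rightarrow> real"
    by (rule ball_cong[OF refl], rule ball_cong[OF refl], rule pointwise)
  show ?thesis
    unfolding coset_weighted_pure_potential_game_iff by (simp only: eq simp_thms)
qed

end
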